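(* Let $n,m \in \mathbb{Z}^+$ be such that $m > 2n$. Then $\mathcal{P}_{n,m}$ is not a polyhedral cone.
   Context: For a positive integer $n$, let $\mathsf{M}_n^{\geq 0}$ denote the set of $n\times n$ real matrices with all entries nonnegative. Define $\mathcal{P}_n = \{ p \in \mathbb{R}[x] : p(A) \geq 0 \text{ for all } A \in \mathsf{M}_n^{\geq 0}\}$, where $p(A)\ge 0$ means that the matrix $p(A)$ is entrywise nonnegative. For a nonnegative integer $m$, define $\mathcal{P}_{n,m} = \{ p \in \mathcal{P}_n : \deg(p) \leq m \}$ (the zero polynomial included). $\mathcal{P}_{n,m}$ is a convex cone in the $(m+1)$-dimensional real vector space of polynomials of degree at most $m$. A cone is polyhedral if it is finitely generated, i.e. equal to $\text{cone}(S) = \{ \sum_{i=1}^k \alpha_i x_i : x_i \in S, \alpha_i \in \mathbb{R}, \alpha_i \ge 0, k \in \mathbb{N} \}$ for some finite set $S$. *)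

theory Defs
  imports
    "Jordan_Normal_Form.Matrix"
    "HOL-Computational_Algebra.Polynomial"
    Complex_Main
begin

text \<open>The value \<open>p(A) = \<Sum>k. p\<^sub>k A\<^sup>k\<close>, for square \<open>A\<close>, with the sum written entrywise because the
  type \<^typ>\<open>'a mat\<close> has no zero element valid for all dimensions, hence no \<^const>\<open>sum\<close>.\<close>

definition poly_mat :: "'a :: comm_ring_1 poly \<Rightarrow> 'a mat \<Rightarrow> 'a mat" where
  "poly_mat p A = mat (dim_row A) (dim_row A)
     (\<lambda>(i, j). \<Sum>k\<le>degree p. (coeff p k \<cdot>\<^sub>m (A ^\<^sub>m k)) $$ (i, j))"

definition nonneg_mats :: "nat \<Rightarrow> real mat set" where
  "nonneg_mats n = {A \<in> carrier_mat n n. 0\<^sub>m n n \<le> A}"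

definition preserving_polys :: "nat \<Rightarrow> real poly set" where
  "preserving_polys n = {p. \<forall>A \<in> nonneg_mats n. poly_mat p A \<in> nonneg_mats n}"

text \<open>The zero polynomial has \<^const>\<open>degree\<close> \<open>0\<close>, so it belongs to the following set for every \<open>m\<close>.\<close>

definition preserving_polys_upto :: "nat \<Rightarrow> nat \<Rightarrow> real poly set" where
  "preserving_polys_upto n m = {p \<in> preserving_polys n. degree p \<le> m}"

text \<open>The type \<^typ>\<open>real poly\<close> is not an instance of \<^class>\<open>real_vector\<close>, so scalar multiplication
  is \<^const>\<open>smult\<close> and the library's convex-cone hull is not available.  The empty combination
  (\<open>k = 0\<close>) is allowed, so \<open>0\<close> always lies in the generated cone.\<close>

definition generated_cone :: "real poly set \<Rightarrow> real poly set" where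
  "generated_cone S =
     {(\<Sum>i<k. smult (\<alpha> i) (x i)) | (k :: nat) \<alpha> x. \<forall>i<k. x i \<in> S \<and> 0 \<le> \<alpha> i}"

definition polyhedral_cone :: "real poly set \<Rightarrow> bool" where
  "polyhedral_cone C \<longleftrightarrow> (\<exists>S. finite S \<and> C = generated_cone S)"

end

theory Submission
  imports Defs
begin

text \<open>
  Two facts about the coefficients of \<open>p\<close> at the exponents divisible by \<open>n\<close> pull against each
  other.

  Evaluating \<open>p\<close> at \<open>s\<close> times the cyclic permutation matrix shows that, for \<open>p\<close> preserving
  nonnegativity, the polynomial formed by the terms of \<open>p\<close> with exponents divisible by \<open>n\<close> (its
  multisection) is nonnegative on \<open>[0, \<infinity>)\<close>: this is \<open>multisection_nonneg\<close>.  Conversely, every square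
  \<open>(x\<^sup>n - c)\<^sup>2\<close> with \<open>c \<ge> 0\<close> is attained as such a multisection: adding a suitable multiple of each power
  \<open>x\<^sup>k\<close> with \<open>0 < k < 2n\<close> and \<open>k \<noteq> n\<close> makes it preserve nonnegativity
  (\<open>padded_square_preserving\<close>).

  For the latter, the only term of concern is \<open>- 2 c A\<^sup>n\<close>.  On the diagonal, the square of
  \<open>h = (A\<^sup>n)\<^sub>i\<^sub>i\<close> is at most the \<open>(i, i)\<close> entry of \<open>A\<close> to the power \<open>2n\<close>, so \<open>(h - c)\<^sup>2 \<ge> 0\<close> already suffices.
  Off the diagonal, \<open>A\<^sup>n\<close> itself is controlled by the padding: a walk of length \<open>n\<close> between two distinct
  vertices among \<open>n\<close> contains a cycle of some length \<open>l < n\<close>; its weight is the geometric mean of the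
  weights of the walks obtained by deleting and by doubling this cycle, and these have lengths
  \<open>n - l\<close> and \<open>n + l\<close> (\<open>off_diagonal_pow_le\<close>).

  Suppose now that finitely many polynomials generate the cone.  Multisection is linear, and when
  \<open>c = t\<^sup>n\<close> the square vanishes at \<open>t\<close>.  By nonnegativity, each generator with positive coefficient in a
  representation of the padded square has a multisection vanishing at \<open>t\<close>.  The nonzero multisections
  of the generators have only finitely many roots, so for all other \<open>t\<close> those multisections are
  zero, and the square would be zero too.
\<close>

section \<open>Nonnegative matrices and their powers\<close>

lemma nonneg_mats_iff:
  "A \<in> nonneg_mats n \<longleftrightarrow> A \<in> carrier_mat n n \<and> (\<forall>i<n. \<forall>j<n. 0 \<le> A $$ (i, j))"
proof (cases "A \<in> carrier_mat n n")
  case True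
  then have "dim_row A = n" "dim_col A = n" by simp_all
  then show ?thesis using True by (simp add: nonneg_mats_def less_eq_mat_def)
qed (simp add: nonneg_mats_def)

lemma index_mult_square_mat:
  assumes "A \<in> carrier_mat n n" "B \<in> carrier_mat n n" "i < n" "j < n"
  shows "(A * B) $$ (i, j) = (\<Sum>l<n. A $$ (i, l) * B $$ (l, j))"
  using assms by (auto simp: scalar_prod_def lessThan_atLeast0)

lemma index_pow_mat_Suc:
  assumes "A \<in> carrier_mat n n" "i < n" "j < n"
  shows "(A ^\<^sub>m Suc k) $$ (i, j) = (\<Sum>l<n. (A ^\<^sub>m k) $$ (i, l) * A $$ (l, j))"
  using index_mult_square_mat[of "A ^\<^sub>m k" n A i j] assms by simp

lemma index_pow_mat_add:
  assumes "A \<in> carrier_mat n n" "i < n" "j < n"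
  shows "(A ^\<^sub>m (k + l)) $$ (i, j) = (\<Sum>r<n. (A ^\<^sub>m k) $$ (i, r) * (A ^\<^sub>m l) $$ (r, j))"
proof -
  have "A ^\<^sub>m (k + l) = A ^\<^sub>m k * A ^\<^sub>m l"
  proof (induction l)
    case (Suc l)
    then show ?case
      using assms(1) by (simp add: assoc_mult_mat[of _ n n _ n _ n])
  qed (use assms(1) in \<open>simp add: pow_carrier_mat[of A n]\<close>)
  then show ?thesis
    using index_mult_square_mat[of "A ^\<^sub>m k" n "A ^\<^sub>m l" i j] assms by simp
qed

lemma pow_mat_nonneg:
  assumes "A \<in> nonneg_mats n" "i < n" "j < n"
  shows "0 \<le> (A ^\<^sub>m k) $$ (i, j)"
  using assms(2,3)
proof (induction k arbitrary: j)
  case 0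
  then show ?case using assms(1) by (auto simp: nonneg_mats_iff)
next
  case (Suc k)
  have c: "A \<in> carrier_mat n n" using assms(1) by (simp add: nonneg_mats_iff)
  have "0 \<le> A $$ (l, j)" if "l < n" for l
    using assms(1) that Suc.prems by (simp add: nonneg_mats_iff)
  then show ?case
    unfolding index_pow_mat_Suc[OF c \<open>i < n\<close> \<open>j < n\<close>] using Suc.IH \<open>i < n\<close>
    by (intro sum_nonneg mult_nonneg_nonneg) simp_all
qed

lemma index_poly_mat:
  assumes "A \<in> carrier_mat n n" "i < n" "j < n" "degree p \<le> m"
  shows "poly_mat p A $$ (i, j) = (\<Sum>k\<le>m. coeff p k * (A ^\<^sub>m k) $$ (i, j))"
proof -
  have "poly_mat p A $$ (i, j) = (\<Sum>k\<le>degree p. coeff p k * (A ^\<^sub>m k) $$ (i, j))"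
    using carrier_matD[OF assms(1)] carrier_matD[OF pow_carrier_mat[OF assms(1)]] assms(2,3)
    by (simp add: poly_mat_def)
  also have "\<dots> = (\<Sum>k\<le>m. coeff p k * (A ^\<^sub>m k) $$ (i, j))"
    using assms(4) by (intro sum.mono_neutral_left) (auto simp: coeff_eq_0)
  finally show ?thesis .
qed

lemma preserving_polys_iff:
  "p \<in> preserving_polys n \<longleftrightarrow>
    (\<forall>A \<in> nonneg_mats n. \<forall>i<n. \<forall>j<n. 0 \<le> poly_mat p A $$ (i, j))"
proof -
  have "poly_mat p A \<in> nonneg_mats n \<longleftrightarrow> (\<forall>i<n. \<forall>j<n. 0 \<le> poly_mat p A $$ (i, j))"
    if "A \<in> nonneg_mats n" for A
  proof -
    have "poly_mat p A \<in> carrier_mat n n"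
      using that by (auto simp: poly_mat_def nonneg_mats_iff)
    then show ?thesis by (simp add: nonneg_mats_iff)
  qed
  then show ?thesis by (simp add: preserving_polys_def)
qed

section \<open>Walks and their weights\<close>

text \<open>A walk is the list of its vertices, so a walk of length \<open>k\<close> has \<open>k + 1\<close> entries; the trivial
  walk \<open>[x]\<close> has weight \<open>1\<close>, as the diagonal of the zeroth power demands.\<close>

fun walk_weight :: "real mat \<Rightarrow> nat list \<Rightarrow> real" where
  "walk_weight A (x # y # zs) = A $$ (x, y) * walk_weight A (y # zs)"
| "walk_weight A _ = 1"

lemma walk_weight_split:
  "walk_weight A (us @ v # ws) = walk_weight A (us @ [v]) * walk_weight A (v # ws)"
proof (induction us)
  case (Cons u us)
  then show ?case by (cases us) simp_all
qed simp

lemma walk_weight_nonneg: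
  assumes "A \<in> nonneg_mats n" "set xs \<subseteq> {..<n}"
  shows "0 \<le> walk_weight A xs"
  using assms(2)
proof (induction xs)
  case (Cons x xs)
  then show ?case using assms(1) by (cases xs) (auto simp: nonneg_mats_iff)
qed simp

text \<open>An entry of a power is the sum of the weights of all walks of that length between its indices; both directions
  of this expansion are needed only as estimates, with a single walk in place of the sum.\<close>

lemma walk_weight_le_pow:
  assumes A: "A \<in> nonneg_mats n" and "set xs \<subseteq> {..<n}" "xs \<noteq> []"
  shows "walk_weight A xs \<le> (A ^\<^sub>m (length xs - 1)) $$ (hd xs, last xs)"
  using assms(2,3)
proof (induction xs rule: rev_induct)
  case (snoc j xs)
  have c: "A \<in> carrier_mat n n" using A by (simp add: nonneg_mats_iff)
  show ?case
  proof (cases xs rule: rev_cases)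
    case Nil
    then show ?thesis using c snoc.prems by auto
  next
    case (snoc ys l)
    have bounds: "hd xs < n" "l < n" "j < n"
      using snoc snoc.prems by (cases ys; auto)+
    have "walk_weight A (xs @ [j]) = walk_weight A xs * A $$ (l, j)"
      using walk_weight_split[of A ys l "[j]"] snoc by simp
    also have "\<dots> \<le> (A ^\<^sub>m (length xs - 1)) $$ (hd xs, l) * A $$ (l, j)"
      using snoc.IH snoc.prems snoc A bounds by (intro mult_right_mono) (auto simp: nonneg_mats_iff)
    also have "\<dots> \<le> (\<Sum>r<n. (A ^\<^sub>m (length xs - 1)) $$ (hd xs, r) * A $$ (r, j))"
      using bounds A pow_mat_nonneg[OF A]
      by (intro member_le_sum) (auto intro!: mult_nonneg_nonneg simp: nonneg_mats_iff)
    also have "\<dots> = (A ^\<^sub>m Suc (length xs - 1)) $$ (hd xs, j)"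
      using index_pow_mat_Suc[OF c, of "hd xs" j "length xs - 1"] bounds by simp
    finally show ?thesis using snoc by (cases ys) simp_all
  qed
qed simp

text \<open>The walk is built greedily from its far end: among the \<open>n\<close> summands of an entry of
  the product, the largest loses at most a factor \<open>n\<close>.  Positivity of the entry guarantees that a
  walk exists at all, since the zeroth power vanishes off the diagonal.\<close>

lemma ex_dominant_walk:
  assumes A: "A \<in> nonneg_mats n" and "i < n" "j < n" "0 < (A ^\<^sub>m k) $$ (i, j)"
  obtains xs where "length xs = Suc k" "hd xs = i" "last xs = j" "set xs \<subseteq> {..<n}"
    and "(A ^\<^sub>m k) $$ (i, j) \<le> real n ^ k * walk_weight A xs"
proof -
  have c: "A \<in> carrier_mat n n" using A by (simp add: nonneg_mats_iff)
  have "\<exists>xs. length xs = Suc k \<and> hd xs = i \<and> last xs = j \<and> set xs \<subseteq> {..<n} \<and>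
      (A ^\<^sub>m k) $$ (i, j) \<le> real n ^ k * walk_weight A xs"
    using assms(3,4)
  proof (induction k arbitrary: j)
    case 0
    then show ?case using c assms(2) by (intro exI[of _ "[i]"]) (auto split: if_splits)
  next
    case (Suc k)
    let ?t = "\<lambda>l. (A ^\<^sub>m k) $$ (i, l) * A $$ (l, j)"
    have entry: "(A ^\<^sub>m Suc k) $$ (i, j) = (\<Sum>l<n. ?t l)"
      using index_pow_mat_Suc[OF c \<open>i < n\<close> \<open>j < n\<close>] .
    have "Max (?t ` {..<n}) \<in> ?t ` {..<n}"
      using \<open>i < n\<close> by (intro Max_in) auto
    then obtain l where l: "l < n" "?t l = Max (?t ` {..<n})" by fastforce
    have "(\<Sum>l<n. ?t l) \<le> (\<Sum>r<n. ?t l)"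
      by (intro sum_mono) (simp add: l)
    then have le: "(A ^\<^sub>m Suc k) $$ (i, j) \<le> real n * ?t l"
      using entry by simp
    with Suc.prems have "0 < real n * ?t l" by linarith
    then have "0 < ?t l" by (simp add: zero_less_mult_iff)
    moreover have Alj: "0 \<le> A $$ (l, j)"
      using A l \<open>j < n\<close> by (simp add: nonneg_mats_iff)
    ultimately have "0 < (A ^\<^sub>m k) $$ (i, l)" by (simp add: zero_less_mult_iff)
    from Suc.IH[OF l(1) this] obtain xs where xs: "length xs = Suc k" "hd xs = i" "last xs = l"
      "set xs \<subseteq> {..<n}" "(A ^\<^sub>m k) $$ (i, l) \<le> real n ^ k * walk_weight A xs"
      by blast
    obtain ys where ys: "xs = ys @ [l]" using xs(1,3) by (cases xs rule: rev_cases) auto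
    have w: "walk_weight A (xs @ [j]) = walk_weight A xs * A $$ (l, j)"
      using walk_weight_split[of A ys l "[j]"] ys by simp
    have "(A ^\<^sub>m Suc k) $$ (i, j) \<le> real n * ((real n ^ k * walk_weight A xs) * A $$ (l, j))"
      using le mult_left_mono[OF mult_right_mono[OF xs(5) Alj], of "real n"] by linarith
    also have "\<dots> = real n ^ Suc k * walk_weight A (xs @ [j])"
      by (simp add: w)
    finally show ?case
      using xs \<open>j < n\<close> ys by (intro exI[of _ "xs @ [j]"]) (auto simp: hd_append)
  qed
  then show ?thesis by (elim exE conjE) (rule that)
qed

text \<open>Take a dominant walk of length \<open>n\<close>.  By the pigeonhole principle it revisits a vertex, and
  since its ends differ, the cycle in between is not the whole walk.  If \<open>b\<close> is the weight of the cycle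
  and \<open>q\<close> that of the rest, then \<open>2 q b \<le> q + q b\<^sup>2\<close>, where the terms on the right are the weights of
  the walks which skip the cycle and which traverse it twice.\<close>

lemma off_diagonal_pow_le:
  assumes A: "A \<in> nonneg_mats n" and "i < n" "j < n" "i \<noteq> j"
  shows "2 * (A ^\<^sub>m n) $$ (i, j) \<le>
    real n ^ n * (\<Sum>k \<in> {0<..<2 * n} - {n}. (A ^\<^sub>m k) $$ (i, j))"
    (is "_ \<le> _ * ?B")
proof (cases "0 < (A ^\<^sub>m n) $$ (i, j)")
  case True
  then obtain xs where xs: "length xs = Suc n" "hd xs = i" "last xs = j" "set xs \<subseteq> {..<n}"
    and dom: "(A ^\<^sub>m n) $$ (i, j) \<le> real n ^ n * walk_weight A xs"
    by (rule ex_dominant_walk[OF A \<open>i < n\<close> \<open>j < n\<close>])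
  have "card (set xs) \<le> n" using card_mono[OF _ xs(4)] by simp
  then have "\<not> distinct xs" using xs(1) distinct_card[of xs] by linarith
  then obtain us v vs ws where dec: "xs = us @ [v] @ vs @ [v] @ ws"
    using not_distinct_decomp by blast
  let ?c = "Suc (length vs)"
  have c: "?c < n"
  proof (rule ccontr)
    assume "\<not> ?c < n"
    then have "us = []" "ws = []" using xs(1) dec by auto
    then show False using xs(2,3) dec \<open>i \<noteq> j\<close> by simp
  qed
  let ?short = "us @ v # ws" and ?long = "us @ v # vs @ v # vs @ v # ws"
  define a b d where "a = walk_weight A (us @ [v])" and "b = walk_weight A (v # vs @ [v])"
    and "d = walk_weight A (v # ws)"
  have prefix: "walk_weight A (us @ v # zs) = a * walk_weight A (v # zs)" for zs
    unfolding a_def by (rule walk_weight_split)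
  have closed: "walk_weight A (v # vs @ v # zs) = b * walk_weight A (v # zs)" for zs
    using walk_weight_split[of A "v # vs" v zs] by (simp add: b_def)
  have weights: "walk_weight A xs = a * b * d" "walk_weight A ?short = a * d"
      "walk_weight A ?long = a * b * b * d"
    by (simp_all add: dec prefix closed d_def)
  have "a \<ge> 0" "d \<ge> 0"
    using xs(4) dec by (auto simp: a_def d_def intro!: walk_weight_nonneg[OF A])
  then have "0 \<le> a * d * (b - 1)\<^sup>2" by simp
  then have "2 * walk_weight A xs \<le> walk_weight A ?short + walk_weight A ?long"
    unfolding weights by (simp add: power2_eq_square algebra_simps)
  also have "\<dots> \<le> (A ^\<^sub>m (n - ?c)) $$ (i, j) + (A ^\<^sub>m (n + ?c)) $$ (i, j)"
  proof (rule add_mono)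
    have ends: "hd ?short = i" "last ?short = j" "hd ?long = i" "last ?long = j"
      using xs(2,3) dec by (auto simp: hd_append split: if_splits)
    have lengths: "length ?short - 1 = n - ?c" "length ?long - 1 = n + ?c"
      using xs(1) dec by auto
    have vertices: "set ?short \<subseteq> {..<n}" "set ?long \<subseteq> {..<n}"
      using xs(4) dec by auto
    show "walk_weight A ?short \<le> (A ^\<^sub>m (n - ?c)) $$ (i, j)"
      using walk_weight_le_pow[OF A vertices(1)] unfolding ends lengths by blast
    show "walk_weight A ?long \<le> (A ^\<^sub>m (n + ?c)) $$ (i, j)"
      using walk_weight_le_pow[OF A vertices(2)] unfolding ends lengths by blast
  qed
  also have "\<dots> = (\<Sum>k \<in> {n - ?c, n + ?c}. (A ^\<^sub>m k) $$ (i, j))"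
    using c by simp
  also have "\<dots> \<le> ?B"
    using c pow_mat_nonneg[OF A \<open>i < n\<close> \<open>j < n\<close>] by (intro sum_mono2) auto
  finally have "real n ^ n * (2 * walk_weight A xs) \<le> real n ^ n * ?B"
    by (intro mult_left_mono) auto
  with dom show ?thesis by linarith
next
  case False
  have "0 \<le> ?B"
    by (intro sum_nonneg pow_mat_nonneg[OF A \<open>i < n\<close> \<open>j < n\<close>])
  then have "0 \<le> real n ^ n * ?B" by simp
  with False show ?thesis by linarith
qed

section \<open>A curve of preserving polynomials\<close>

text \<open>The padding coefficient \<open>c n\<^sup>n\<close> is the factor \<open>n\<^sup>n\<close> of \<open>off_diagonal_pow_le\<close>, scaled by the size
  of the negative coefficient.\<close>

definition padded_square :: "nat \<Rightarrow> real \<Rightarrow> real poly" where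
  "padded_square n c = (monom 1 n - [:c:])\<^sup>2
     + (\<Sum>k \<in> {0<..<2 * n} - {n}. monom (c * real n ^ n) k)"

lemma square_monom_minus_const:
  "(monom 1 n - [:c:])\<^sup>2 = monom 1 (2 * n) - monom (2 * c) n + monom (c\<^sup>2) (0 :: nat)"
  for c :: "'a :: comm_ring_1"
proof -
  have "monom (2 * c) n = monom c n + monom c n" unfolding add_monom mult_2 ..
  moreover have "[:c:] = monom c 0" by (simp add: monom_0)
  ultimately show ?thesis
    unfolding power2_eq_square left_diff_distrib right_diff_distrib mult_2
    by (simp add: mult_monom)
qed

lemma coeff_padded_square:
  assumes "n > 0"
  shows "coeff (padded_square n c) k =
    (if k = 0 then c\<^sup>2 else if k = n then - 2 * c else if k = 2 * n then 1
     else if k < 2 * n then c * real n ^ n else 0)"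
  using assms by (auto simp: padded_square_def square_monom_minus_const coeff_sum)

lemma degree_padded_square: "n > 0 \<Longrightarrow> degree (padded_square n c) \<le> 2 * n"
  by (rule degree_le) (simp add: coeff_padded_square)

lemma padded_square_preserving:
  assumes n: "n > 0" and c: "c \<ge> 0"
  shows "padded_square n c \<in> preserving_polys n"
  unfolding preserving_polys_iff
proof (intro ballI allI impI)
  fix A i j
  assume A: "A \<in> nonneg_mats n" and ij: "i < n" "j < n"
  have cm: "A \<in> carrier_mat n n" using A by (simp add: nonneg_mats_iff)
  define E where "E k = (A ^\<^sub>m k) $$ (i, j)" for k
  define B where "B = (\<Sum>k \<in> {0<..<2 * n} - {n}. E k)"
  have E: "E k \<ge> 0" for k using pow_mat_nonneg[OF A ij] by (simp add: E_def)
  have B: "B \<ge> 0" using E by (simp add: B_def sum_nonneg)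
  have split: "{..2 * n} = insert 0 (insert n (insert (2 * n) ({0<..<2 * n} - {n})))"
    using n by auto
  have "poly_mat (padded_square n c) A $$ (i, j) = (\<Sum>k\<le>2 * n. coeff (padded_square n c) k * E k)"
    using index_poly_mat[OF cm ij degree_padded_square[OF n]] by (simp add: E_def)
  also have "\<dots> = c\<^sup>2 * E 0 - 2 * c * E n + E (2 * n)
      + (\<Sum>k \<in> {0<..<2 * n} - {n}. coeff (padded_square n c) k * E k)"
    unfolding split using n by (simp add: coeff_padded_square)
  also have "(\<Sum>k \<in> {0<..<2 * n} - {n}. coeff (padded_square n c) k * E k) = c * real n ^ n * B"
    unfolding B_def sum_distrib_left by (intro sum.cong) (auto simp: coeff_padded_square[OF n])
  finally have eq: "poly_mat (padded_square n c) A $$ (i, j) =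
      c\<^sup>2 * E 0 - 2 * c * E n + E (2 * n) + c * real n ^ n * B" .
  (* The constant term contributes only on the diagonal, which is also the only place
     where the padding need not dominate the negative term. *)
  show "0 \<le> poly_mat (padded_square n c) A $$ (i, j)"
  proof (cases "i = j")
    case True
    have "(E n)\<^sup>2 = (A ^\<^sub>m n) $$ (i, i) * (A ^\<^sub>m n) $$ (i, i)"
      using True by (simp add: E_def power2_eq_square)
    also have "\<dots> \<le> (\<Sum>r<n. (A ^\<^sub>m n) $$ (i, r) * (A ^\<^sub>m n) $$ (r, i))"
      using ij pow_mat_nonneg[OF A]
      by (intro member_le_sum[where f = "\<lambda>r. (A ^\<^sub>m n) $$ (i, r) * (A ^\<^sub>m n) $$ (r, i)"])
        (auto intro!: mult_nonneg_nonneg)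
    also have "\<dots> = E (2 * n)"
      using index_pow_mat_add[OF cm ij, of n n] True by (simp add: E_def mult_2)
    finally have "(E n - c)\<^sup>2 \<le> c\<^sup>2 - 2 * c * E n + E (2 * n)"
      by (simp add: power2_eq_square algebra_simps)
    then have "0 \<le> c\<^sup>2 - 2 * c * E n + E (2 * n)"
      by (rule order_trans[OF zero_le_power2])
    moreover have "E 0 = 1" using True ij cm by (simp add: E_def)
    moreover have "0 \<le> c * real n ^ n * B" using c B by simp
    ultimately show ?thesis
      unfolding eq by simp
  next
    case False
    have "c * (2 * E n) \<le> c * (real n ^ n * B)"
      using off_diagonal_pow_le[OF A ij False] c unfolding E_def B_def by (intro mult_left_mono)
    moreover have "0 \<le> c\<^sup>2 * E 0" "0 \<le> E (2 * n)" using E by simp_all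
    ultimately show ?thesis unfolding eq by (simp add: algebra_simps)
  qed
qed

section \<open>Multisections\<close>

definition multisection :: "nat \<Rightarrow> real poly \<Rightarrow> real poly" where
  "multisection n p = (\<Sum>k\<le>degree p. monom (if n dvd k then coeff p k else 0) k)"

lemma coeff_multisection: "coeff (multisection n p) k = (if n dvd k then coeff p k else 0)"
  by (auto simp: multisection_def coeff_sum coeff_eq_0)

lemma multisection_sum_smult:
  "multisection n (\<Sum>i\<in>I. smult (\<alpha> i) (x i)) = (\<Sum>i\<in>I. smult (\<alpha> i) (multisection n (x i)))"
  by (rule poly_eqI) (auto simp: coeff_multisection coeff_sum)

definition cyclic_mat :: "nat \<Rightarrow> real \<Rightarrow> real mat" where
  "cyclic_mat n s = mat n n (\<lambda>(i, j). if j = Suc i mod n then s else 0)"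

text \<open>The matrix is \<open>s\<close> times a permutation matrix: from vertex \<open>0\<close>, the unique walk of length \<open>k\<close>
  ends at \<open>k mod n\<close>.\<close>

lemma cyclic_mat_pow_row_0:
  assumes "j < n"
  shows "(cyclic_mat n s ^\<^sub>m k) $$ (0, j) = (if j = k mod n then s ^ k else 0)"
  using assms
proof (induction k arbitrary: j)
  case 0
  then show ?case by (auto simp: cyclic_mat_def)
next
  case (Suc k)
  have "(cyclic_mat n s ^\<^sub>m Suc k) $$ (0, j) =
      (\<Sum>l<n. (cyclic_mat n s ^\<^sub>m k) $$ (0, l) * cyclic_mat n s $$ (l, j))"
    using Suc.prems by (intro index_pow_mat_Suc) (auto simp: cyclic_mat_def)
  also have "\<dots> = (\<Sum>l<n. if l = k mod n then s ^ k * cyclic_mat n s $$ (l, j) else 0)"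
    using Suc.IH by (intro sum.cong) auto
  also have "\<dots> = s ^ k * cyclic_mat n s $$ (k mod n, j)"
    using Suc.prems by simp
  also have "\<dots> = (if j = Suc k mod n then s ^ Suc k else 0)"
    using Suc.prems by (simp add: cyclic_mat_def mod_Suc_eq)
  finally show ?case .
qed

text \<open>The value is the \<open>(0, 0)\<close> entry of \<open>p\<close> at \<open>cyclic_mat n s\<close>, since only the powers with exponent
  divisible by \<open>n\<close> return to vertex \<open>0\<close>.\<close>

lemma multisection_nonneg:
  assumes "p \<in> preserving_polys n" "n > 0" "s \<ge> 0"
  shows "0 \<le> poly (multisection n p) s"
proof -
  have A: "cyclic_mat n s \<in> nonneg_mats n"
    using assms(3) by (auto simp: nonneg_mats_iff cyclic_mat_def)
  then have "0 \<le> poly_mat p (cyclic_mat n s) $$ (0, 0)"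
    using assms(1,2) by (simp add: preserving_polys_iff)
  also have "\<dots> = (\<Sum>k\<le>degree p. coeff p k * (cyclic_mat n s ^\<^sub>m k) $$ (0, 0))"
    using A assms(2) by (intro index_poly_mat) (auto simp: nonneg_mats_iff)
  also have "\<dots> = poly (multisection n p) s"
    using assms(2)
    by (auto simp: multisection_def poly_sum poly_monom cyclic_mat_pow_row_0
        dvd_eq_mod_eq_0 intro!: sum.cong)
  finally show ?thesis .
qed

lemma multisection_padded_square:
  assumes "n > 0"
  shows "multisection n (padded_square n c) = (monom 1 n - [:c:])\<^sup>2"
proof (rule poly_eqI)
  fix k
  have "k = 0 \<or> k = n" if "n dvd k" "k < 2 * n"
    using that by (elim dvdE) (simp add: less_2_cases_iff)
  then show "coeff (multisection n (padded_square n c)) k = coeff ((monom 1 n - [:c:])\<^sup>2) k"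
    using assms unfolding square_monom_minus_const
    by (cases "n dvd k") (auto simp: coeff_multisection coeff_padded_square)
qed

section \<open>Failure of finite generation\<close>

lemma generator_in_generated_cone: "x \<in> S \<Longrightarrow> x \<in> generated_cone S"
  unfolding generated_cone_def
  by (intro CollectI exI[of _ "1::nat"] exI[of _ "\<lambda>_. 1"] exI[of _ "\<lambda>_. x"]) simp

theorem corollary3p4:
  fixes n m :: nat
  assumes "n > 0" and "m > 0" and "m > 2 * n"
  shows "\<not> polyhedral_cone (preserving_polys_upto n m)"
proof
  assume "polyhedral_cone (preserving_polys_upto n m)"
  then obtain S where S: "finite S" "preserving_polys_upto n m = generated_cone S"
    by (auto simp: polyhedral_cone_def)
  (* Outside R, the multisection of a generator vanishes only if it is identically zero. *)
  define R where "R = (\<Union>x \<in> {x \<in> S. multisection n x \<noteq> 0}. {s. poly (multisection n x) s = 0})"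
  have "finite R"
    using S(1) by (auto simp: R_def poly_roots_finite)
  then obtain t where t: "t > 0" "t \<notin> R"
    using infinite_Ioi[of "0::real"] finite_subset[of "{0<..}" R] by auto
  let ?p = "padded_square n (t ^ n)"
  have "?p \<in> generated_cone S"
    using padded_square_preserving[of n "t ^ n"] degree_padded_square[of n "t ^ n"] assms t(1)
    by (simp add: preserving_polys_upto_def flip: S(2))
  then obtain k :: nat and \<alpha> x where p: "?p = (\<Sum>i<k. smult (\<alpha> i) (x i))"
    and gens: "\<And>i. i < k \<Longrightarrow> x i \<in> S \<and> 0 \<le> \<alpha> i"
    unfolding generated_cone_def by blast
  have nonneg: "0 \<le> poly (multisection n (x i)) t" if "i < k" for i
    using that gens generator_in_generated_cone[of "x i" S] S(2) assms(1) t(1)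
    by (intro multisection_nonneg) (auto simp: preserving_polys_upto_def)
  have sect: "(monom 1 n - [:t ^ n:])\<^sup>2 = (\<Sum>i<k. smult (\<alpha> i) (multisection n (x i)))"
    using multisection_padded_square[OF assms(1), of "t ^ n"] p
    by (simp add: multisection_sum_smult)
  have "(\<Sum>i<k. \<alpha> i * poly (multisection n (x i)) t) = poly ((monom 1 n - [:t ^ n:])\<^sup>2) t"
    unfolding sect by (simp add: poly_sum)
  also have "\<dots> = 0" by (simp add: poly_monom)
  finally have zero: "\<alpha> i * poly (multisection n (x i)) t = 0" if "i < k" for i
    using that nonneg gens by (subst (asm) sum_nonneg_eq_0_iff) auto
  have "smult (\<alpha> i) (multisection n (x i)) = 0" if "i < k" for i
    using zero[OF that] gens[OF that] t(2) by (auto simp: R_def)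
  then have "(monom 1 n - [:t ^ n:])\<^sup>2 = (0 :: real poly)"
    unfolding sect by (intro sum.neutral) simp
  then have "monom 1 n = [:t ^ n:]" by simp
  then have "coeff (monom 1 n) n = coeff [:t ^ n:] n" by simp
  then show False using assms(1) by (simp add: coeff_pCons split: nat.splits)
qed

end
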